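(* Let $b$ and $c$ be integers with $b>c\geq 1$, and let $a=2^c$. Let $G$ be the graph obtained from a path on $2^{b-c}$ vertices by replacing each vertex with a clique on $\frac{a}{2}=2^{c-1}$ vertices and replacing each edge by a complete bipartite graph between the two corresponding cliques. Then $\operatorname{pw}(G)=a-1$, the graph $G$ contains no path on $2^b$ vertices as a subgraph, and $\operatorname{td}(G)\geq\frac{a}{2}(b-c)$.
   Context: All graphs are finite and simple (no loops or parallel edges). Paths are subgraphs, not necessarily induced. Pathwidth: a path decomposition of a graph $G$ is a pair $(P,\{B_t\}_{t\in V(P)})$ where $P$ is a path (its vertices are called nodes) and each $B_t\subseteq V(G)$ is a set called a bag, such that (1) for every edge $uv\in E(G)$ there is a bag containing both $u$ and $v$, and (2) for every vertex $v\in V(G)$ the set of nodes $t$ with $v\in B_t$ induces a non-empty subpath of $P$. Its width is the maximum size of a bag minus $1$. The pathwidth $\operatorname{pw}(G)$ is the minimum width of a path decomposition of $G$. Treedepth: a rooted forest is a disjoint union of rooted trees; its height is the maximum number of vertices on a path from a root to a leaf. A vertex $u$ is an ancestor of a vertex $v$ in a rooted forest $F$ if $u$ lies on the unique path from a root to $v$ in $F$. A rooted forest $F$ is an elimination forest of $G$ if $V(F)=V(G)$ and for every edge $uv$ of $G$ one of $u,v$ is an ancestor of the other in $F$. The treedepth $\operatorname{td}(G)$ is the minimum height of an elimination forest of $G$. *)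

theory Defs
  imports Complex_Main "Graph_Theory.Graph_Theory"
begin

text \<open>
  A finite simple graph is a \<^locale>\<open>pair_graph\<close>: a finite, loop-free, symmetric digraph without
  parallel arcs, so that an edge is a pair of opposite arcs. A path on \<open>n\<close> vertices contained in
  \<open>G\<close> as a (not necessarily induced) subgraph is a \<^const>\<open>vpath\<close> of \<open>G\<close>, i.e. its list of \<open>n\<close>
  distinct vertices.
\<close>

definition path_graph :: "nat \<Rightarrow> nat pair_pre_digraph" where
  "path_graph n =
    \<lparr> pverts = {..<n},
      parcs = {(i, j). i < n \<and> j < n \<and> (j = Suc i \<or> i = Suc j)} \<rparr>"

text \<open>
  Every vertex \<open>u\<close> of \<open>H\<close> becomes the clique \<open>{u} \<times> {..<k}\<close>, and every edge of \<open>H\<close> becomes a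
  complete bipartite graph between the two cliques.
\<close>
definition clique_blowup :: "'a pair_pre_digraph \<Rightarrow> nat \<Rightarrow> ('a \<times> nat) pair_pre_digraph" where
  "clique_blowup H k =
    \<lparr> pverts = pverts H \<times> {..<k},
      parcs = {((u, i), (v, j)) | u i v j.
        u \<in> pverts H \<and> v \<in> pverts H \<and> i < k \<and> j < k \<and>
        (u = v \<and> i \<noteq> j \<or> (u, v) \<in> parcs H)} \<rparr>"

lemma pair_graph_path_graph: "pair_graph (path_graph n)"
proof -
  have "finite (parcs (path_graph n))"
    by (rule finite_subset[of _ "{..<n} \<times> {..<n}"]) (auto simp: path_graph_def)
  then show ?thesis
    by unfold_locales (auto simp: path_graph_def symmetric_def sym_def)
qed

lemma pair_graph_clique_blowup:
  assumes "pair_graph H"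
  shows "pair_graph (clique_blowup H k)"
proof -
  interpret pair_graph H by fact
  have "parcs (clique_blowup H k) \<subseteq> (pverts H \<times> {..<k}) \<times> (pverts H \<times> {..<k})"
    by (auto simp: clique_blowup_def)
  then have "finite (parcs (clique_blowup H k))"
    by (rule finite_subset) (simp add: pair_finite_verts)
  then show ?thesis
    by unfold_locales
      (auto simp: clique_blowup_def symmetric_def sym_def pair_finite_verts
        dest: no_loops' arcs_symmetric)
qed


subsection \<open>Pathwidth\<close>

text \<open>
  The nodes of the underlying path are the positions of the list \<open>Bs\<close> of bags, in order; thus its
  non-empty subpaths are the intervals \<open>{i..j}\<close> of positions.
\<close>
definition path_decomposition :: "'a pair_pre_digraph \<Rightarrow> 'a set list \<Rightarrow> bool" where
  "path_decomposition G Bs \<longleftrightarrow>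
    Bs \<noteq> [] \<and>
    (\<forall>B\<in>set Bs. B \<subseteq> pverts G) \<and>
    (\<forall>(u, v)\<in>parcs G. \<exists>B\<in>set Bs. u \<in> B \<and> v \<in> B) \<and>
    (\<forall>v\<in>pverts G. \<exists>i j. i \<le> j \<and> j < length Bs \<and> {t. t < length Bs \<and> v \<in> Bs ! t} = {i..j})"

definition decomposition_width :: "'a set list \<Rightarrow> int" where
  "decomposition_width Bs = int (Max (card ` set Bs)) - 1"

definition pathwidth :: "'a pair_pre_digraph \<Rightarrow> int" where
  "pathwidth G = (LEAST w. \<exists>Bs. path_decomposition G Bs \<and> decomposition_width Bs = w)"


subsection \<open>Treedepth\<close>

text \<open>
  A rooted forest is represented with all edges directed from parent to child. The notion
  \<^const>\<open>forest\<close> of the graph library is not suitable here: it only excludes directed cycles, so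
  it allows several parents.
\<close>
definition rooted_forest :: "'a pair_pre_digraph \<Rightarrow> bool" where
  "rooted_forest F \<longleftrightarrow>
    pair_fin_digraph F \<and> acyclic (parcs F) \<and> (\<forall>v\<in>pverts F. in_degree F v \<le> 1)"

definition roots :: "'a pair_pre_digraph \<Rightarrow> 'a set" where
  "roots F = {v \<in> pverts F. in_degree F v = 0}"

definition leaves :: "'a pair_pre_digraph \<Rightarrow> 'a set" where
  "leaves F = {v \<in> pverts F. out_degree F v = 0}"

definition ancestor :: "'a pair_pre_digraph \<Rightarrow> 'a \<Rightarrow> 'a \<Rightarrow> bool" where
  "ancestor F u v \<longleftrightarrow> (\<exists>p. vpath p F \<and> hd p \<in> roots F \<and> last p = v \<and> u \<in> set p)"

text \<open>The inserted \<open>0\<close> only matters for the forest without vertices, which has height \<open>0\<close>.\<close>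
definition forest_height :: "'a pair_pre_digraph \<Rightarrow> nat" where
  "forest_height F =
    Max (insert 0 {length p | p. vpath p F \<and> hd p \<in> roots F \<and> last p \<in> leaves F})"

definition elimination_forest :: "'a pair_pre_digraph \<Rightarrow> 'a pair_pre_digraph \<Rightarrow> bool" where
  "elimination_forest G F \<longleftrightarrow>
    rooted_forest F \<and> pverts F = pverts G \<and>
    (\<forall>(u, v)\<in>parcs G. ancestor F u v \<or> ancestor F v u)"

definition treedepth :: "'a pair_pre_digraph \<Rightarrow> nat" where
  "treedepth G = (LEAST h. \<exists>F. elimination_forest G F \<and> forest_height F = h)"

end

theory Submission
  imports Defs
begin

text \<open>
  Write \<open>k = a / 2\<close> and \<open>m = b - c\<close>, so that \<open>G\<close> is the blow-up of a path on \<open>2 ^ m\<close> vertices by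
  cliques of size \<open>k\<close>, called columns below.

  Two consecutive columns form a clique of size \<open>2 * k = a\<close>. By the Helly property of intervals a
  clique lies in a single bag (\<open>clique_subset_bag\<close>), which bounds the pathwidth from below; taking
  the pairs of consecutive columns as bags attains the bound. A path on \<open>2 ^ b\<close> vertices does not
  exist since \<open>G\<close> has only \<open>2 ^ m * k = 2 ^ (b - 1)\<close> vertices.

  For the treedepth, order the vertices by reachability in an elimination forest. This is a partial
  order in which the elements below a given one form a chain, and adjacent vertices are comparable.
  The elements of such a chain all lie on one path from a root to a leaf, so it suffices to find a
  chain of \<open>k * m\<close> vertices. Any interval of columns contains a column that is
  comparable to the whole interval (\<open>ex_universal_column\<close>): as long as every column retains a
  vertex, the remaining graph is connected, hence has a least element, and that element is comparable
  to everything. Such a column can be joined to any chain found in the longer of the two intervals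
  that it leaves, so an interval of \<open>2 ^ m - 1\<close> columns contains a chain of \<open>m\<close> times \<open>k\<close>
  vertices (\<open>ex_chain\<close>).
\<close>


section \<open>Pathwidth\<close>

text \<open>
  The Helly property for the intervals of bags of the vertices in \<open>K\<close>: they meet pairwise, so the
  largest left end point \<open>l u\<close> belongs to all of them.
\<close>
lemma clique_subset_bag:
  assumes dec: "path_decomposition G Bs"
    and K: "finite K" "K \<noteq> {}" "K \<subseteq> pverts G"
    and clique: "\<And>u v. u \<in> K \<Longrightarrow> v \<in> K \<Longrightarrow> u \<noteq> v \<Longrightarrow> (u, v) \<in> parcs G"
  shows "\<exists>B\<in>set Bs. K \<subseteq> B"
proof -
  have "\<forall>v\<in>K. \<exists>i j. i \<le> j \<and> j < length Bs \<and> {t. t < length Bs \<and> v \<in> Bs ! t} = {i..j}"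
    using dec K(3) by (auto simp: path_decomposition_def)
  then obtain l r where lr: "l v \<le> r v" "r v < length Bs"
    "{t. t < length Bs \<and> v \<in> Bs ! t} = {l v..r v}" if "v \<in> K" for v
    by metis
  have mem: "v \<in> Bs ! t \<longleftrightarrow> l v \<le> t \<and> t \<le> r v" if "v \<in> K" "t < length Bs" for v t
    using lr(3)[OF that(1)] that(2) by (auto simp: set_eq_iff)
  have "Max (l ` K) \<in> l ` K" using K(1,2) by (intro Max_in) auto
  then obtain u where u: "u \<in> K" "\<And>v. v \<in> K \<Longrightarrow> l v \<le> l u"
    using K(1) by (smt (verit) Max_ge finite_imageI imageE imageI)
  have "v \<in> Bs ! l u" if v: "v \<in> K" for v
  proof (cases "v = u")
    case True
    then show ?thesis using mem[OF u(1), of "l u"] lr[OF u(1)] by auto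
  next
    case False
    then obtain t where "t < length Bs" "u \<in> Bs ! t" "v \<in> Bs ! t"
      using clique[OF u(1) v] dec by (force simp: path_decomposition_def in_set_conv_nth)
    then show ?thesis
      using mem[OF u(1), of t] mem[OF v, of t] mem[OF v, of "l u"] u(2)[OF v] lr[OF u(1)] by auto
  qed
  then show ?thesis using lr(1,2)[OF u(1)] by (intro bexI[of _ "Bs ! l u"]) auto
qed

lemma decomposition_width_ge:
  assumes "finite (pverts G)" "path_decomposition G Bs" "B \<in> set Bs" "K \<subseteq> B"
  shows "int (card K) - 1 \<le> decomposition_width Bs"
proof -
  have "finite B" using assms by (auto simp: path_decomposition_def intro: finite_subset)
  then have "card K \<le> card B" using assms(4) by (rule card_mono)
  also have "\<dots> \<le> Max (card ` set Bs)" using assms(3) by simp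
  finally show ?thesis by (simp add: decomposition_width_def)
qed

lemma path_decomposition_blowup:
  assumes "2 \<le> n"
  shows "path_decomposition (clique_blowup (path_graph n) k)
    (map (\<lambda>i. {i, Suc i} \<times> {..<k}) [0..<n - 1])" (is "path_decomposition ?G ?Bs")
proof -
  have arcs: "\<exists>B\<in>set ?Bs. u \<in> B \<and> v \<in> B" if uv: "(u, v) \<in> parcs ?G" for u v
  proof -
    obtain i j where ij: "fst u < n" "fst v < n" "snd u < k" "snd v < k"
      "fst u = fst v \<or> fst v = Suc (fst u) \<or> fst u = Suc (fst v)"
      using uv by (auto simp: clique_blowup_def path_graph_def)
    \<comment> \<open>The cap \<open>n - 2\<close> is for arcs inside the last column, which starts no bag.\<close>
    define t where "t = min (min (fst u) (fst v)) (n - 2)"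
    have "t < n - 1" "fst u \<in> {t, Suc t}" "fst v \<in> {t, Suc t}"
      using ij assms by (auto simp: t_def)
    then show ?thesis using ij
      by (intro bexI[of _ "{t, Suc t} \<times> {..<k}"]) (auto simp: mem_Times_iff)
  qed
  have verts: "\<exists>i j. i \<le> j \<and> j < length ?Bs \<and> {t. t < length ?Bs \<and> v \<in> ?Bs ! t} = {i..j}"
    if "v \<in> pverts ?G" for v
  proof -
    have v: "fst v < n" "snd v < k" using that by (auto simp: clique_blowup_def path_graph_def)
    have "t < length ?Bs \<and> v \<in> ?Bs ! t \<longleftrightarrow> fst v - 1 \<le> t \<and> t \<le> min (fst v) (n - 2)" for t
    proof (cases "t < n - 1")
      case True
      then have "v \<in> ?Bs ! t \<longleftrightarrow> fst v = t \<or> fst v = Suc t"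
        using v(2) by (auto simp: mem_Times_iff)
      then show ?thesis using True by auto
    next
      case False
      then show ?thesis using assms by auto
    qed
    then have "{t. t < length ?Bs \<and> v \<in> ?Bs ! t} = {fst v - 1..min (fst v) (n - 2)}"
      unfolding set_eq_iff mem_Collect_eq atLeastAtMost_iff by (rule allI)
    moreover have "fst v - 1 \<le> min (fst v) (n - 2)" "min (fst v) (n - 2) < length ?Bs"
      using v assms by auto
    ultimately show ?thesis by blast
  qed
  show ?thesis
    unfolding path_decomposition_def using assms arcs verts
    by (auto simp: clique_blowup_def path_graph_def)
qed

lemma pathwidth_blowup_path:
  assumes "2 \<le> n" "1 \<le> k"
  shows "pathwidth (clique_blowup (path_graph n) k) = 2 * int k - 1"
  unfolding pathwidth_def
proof (rule Least_equality)
  let ?G = "clique_blowup (path_graph n) k"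
  let ?Bs = "map (\<lambda>i. {i, Suc i} \<times> {..<k}) [0..<n - 1]"
  have "card ` set ?Bs = {2 * k}"
    using assms(1) by (simp add: image_image card_cartesian_product image_constant_conv)
  then have "decomposition_width ?Bs = 2 * int k - 1"
    by (simp add: decomposition_width_def)
  then show "\<exists>Bs. path_decomposition ?G Bs \<and> decomposition_width Bs = 2 * int k - 1"
    using path_decomposition_blowup[OF assms(1)] by blast
next
  let ?G = "clique_blowup (path_graph n) k"
  let ?K = "{0, 1::nat} \<times> {..<k}"
  fix w
  assume "\<exists>Bs. path_decomposition ?G Bs \<and> decomposition_width Bs = w"
  then obtain Bs where Bs: "path_decomposition ?G Bs" "decomposition_width Bs = w" by blast
  have "\<exists>B\<in>set Bs. ?K \<subseteq> B"
    using assms by (intro clique_subset_bag[OF Bs(1)])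
      (auto simp: clique_blowup_def path_graph_def lessThan_empty_iff)
  then obtain B where "B \<in> set Bs" "?K \<subseteq> B" by blast
  with Bs have "int (card ?K) - 1 \<le> w"
    by (metis decomposition_width_ge pair_fin_digraph.pair_finite_verts pair_graph.axioms(1)
      pair_digraph.axioms(1) pair_graph_clique_blowup pair_graph_path_graph)
  then show "2 * int k - 1 \<le> w" by (simp add: card_cartesian_product)
qed


section \<open>Chains in forest orders\<close>

text \<open>
  The order of a rooted forest, with roots as minimal elements.
\<close>
locale forest_order =
  fixes le :: "'v \<Rightarrow> 'v \<Rightarrow> bool" (infix \<open>\<preceq>\<close> 50)
  assumes refl: "x \<preceq> x"
    and antisym: "x \<preceq> y \<Longrightarrow> y \<preceq> x \<Longrightarrow> x = y"
    and trans: "x \<preceq> y \<Longrightarrow> y \<preceq> z \<Longrightarrow> x \<preceq> z"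
    and lower_set_chain: "x \<preceq> z \<Longrightarrow> y \<preceq> z \<Longrightarrow> x \<preceq> y \<or> y \<preceq> x"
begin

definition comparable :: "'v \<Rightarrow> 'v \<Rightarrow> bool" where
  "comparable x y \<longleftrightarrow> x \<preceq> y \<or> y \<preceq> x"

lemma comparable_sym: "comparable x y \<Longrightarrow> comparable y x"
  by (auto simp: comparable_def)

lemma finite_minimal:
  assumes "finite Y" "Y \<noteq> {}"
  shows "\<exists>r\<in>Y. \<forall>y\<in>Y. y \<preceq> r \<longrightarrow> y = r"
proof -
  have "\<exists>r\<in>Y. \<forall>y\<in>Y. y \<noteq> r \<longrightarrow> \<not> (y \<preceq> r \<and> y \<noteq> r)"
    using assms by (intro Finite_Set.bex_min_element)
      (auto intro!: asymp_onI transp_onI dest: antisym trans)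
  then show ?thesis by blast
qed

lemma finite_maximal:
  assumes "finite Y" "Y \<noteq> {}"
  shows "\<exists>r\<in>Y. \<forall>y\<in>Y. r \<preceq> y \<longrightarrow> y = r"
proof -
  have "\<exists>r\<in>Y. \<forall>y\<in>Y. y \<noteq> r \<longrightarrow> \<not> (r \<preceq> y \<and> y \<noteq> r)"
    using assms by (intro Finite_Set.bex_max_element[where R = "\<lambda>x y. x \<preceq> y \<and> y \<noteq> x"])
      (auto intro!: asymp_onI transp_onI dest: antisym trans)
  then show ?thesis by blast
qed

text \<open>
  Lying above a minimal element \<open>r\<close> propagates along comparabilities within \<open>Y\<close>: if \<open>v \<preceq> u\<close>,
  then \<open>r\<close> and \<open>v\<close> are both below \<open>u\<close>, hence comparable. So \<open>r\<close> is the least element of every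
  connected set in which it is minimal.
\<close>
lemma minimal_le_comparable:
  assumes min: "\<And>y. y \<in> Y \<Longrightarrow> y \<preceq> r \<Longrightarrow> y = r"
    and "r \<preceq> u" "comparable u v" "v \<in> Y"
  shows "r \<preceq> v"
proof (cases "u \<preceq> v")
  case True
  then show ?thesis using assms(2) trans by blast
next
  case False
  then have "v \<preceq> u" using assms(3) by (auto simp: comparable_def)
  then show ?thesis using lower_set_chain[OF assms(2)] min[OF assms(4)] by blast
qed

end

text \<open>
  The vertices of the blow-up are pairs of a column \<open>i < n\<close> and an index \<open>p < k\<close> in that column. The
  locale states for the order what an elimination forest provides.
\<close>
locale forest_order_blowup = forest_order le
  for le :: "nat \<times> nat \<Rightarrow> nat \<times> nat \<Rightarrow> bool" (infix \<open>\<preceq>\<close> 50) +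
  fixes n k :: nat
  assumes adjacent_columns: "i < n \<Longrightarrow> j < n \<Longrightarrow> p < k \<Longrightarrow> q < k \<Longrightarrow>
    i = j \<or> j = Suc i \<or> i = Suc j \<Longrightarrow> comparable (i, p) (j, q)"
begin

text \<open>
  Otherwise each column would retain a vertex after deleting the vertices that are comparable to the
  whole interval. The remaining set \<open>Y\<close> is then connected, so a minimal element \<open>r\<close> of it is its
  least element. The deleted vertices are comparable to \<open>r\<close> as well, so \<open>r\<close> should have been deleted.
\<close>
lemma ex_universal_column:
  assumes "l < h" "h \<le> n"
  shows "\<exists>x\<in>{l..<h}. \<forall>p<k. \<forall>y\<in>{l..<h} \<times> {..<k}. comparable (x, p) y"
proof (rule ccontr)
  let ?X = "{l..<h} \<times> {..<k}"
  assume contra: "\<not> ?thesis"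
  define Y where "Y = {y \<in> ?X. \<exists>z\<in>?X. \<not> comparable y z}"
  have Y_meets: "\<exists>p<k. (x, p) \<in> Y" if "x \<in> {l..<h}" for x
    using contra that by (auto simp: Y_def)
  have "Y \<noteq> {}" using Y_meets[of l] assms(1) by auto
  moreover have "finite Y" by (simp add: Y_def)
  ultimately have "\<exists>r\<in>Y. \<forall>y\<in>Y. y \<preceq> r \<longrightarrow> y = r" by (intro finite_minimal)
  then obtain r where r: "r \<in> Y" "\<And>y. y \<in> Y \<Longrightarrow> y \<preceq> r \<Longrightarrow> y = r"
    by blast
  obtain x0 p0 where r_eq: "r = (x0, p0)" "x0 \<in> {l..<h}" "p0 < k"
    using r(1) by (auto simp: Y_def)
  have below: "r \<preceq> (x, p)" if "(x, p) \<in> Y" "x = x0 + d \<or> x0 = x + d" for x p d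
    using that
  proof (induction d arbitrary: x p)
    case 0
    then have "comparable r (x, p)"
      using r_eq assms(2) by (auto simp: Y_def intro!: adjacent_columns)
    then show ?case
      using minimal_le_comparable[OF r(2) refl _ 0(1)] by blast
  next
    case (Suc d)
    \<comment> \<open>The column \<open>x'\<close> next to \<open>x\<close> on the side of \<open>x0\<close> is one step closer to \<open>x0\<close>.\<close>
    obtain x' where x': "x' \<in> {l..<h}" "x' = x0 + d \<or> x0 = x' + d" "x = Suc x' \<or> x' = Suc x"
    proof (cases "x = x0 + Suc d")
      case True
      then show ?thesis using that[of "x0 + d"] Suc.prems(1) r_eq(2) by (auto simp: Y_def)
    next
      case False
      then show ?thesis using that[of "Suc x"] Suc.prems r_eq(2) by (auto simp: Y_def)
    qed
    obtain p' where p': "p' < k" "(x', p') \<in> Y" using Y_meets[OF x'(1)] by blast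
    have "comparable (x', p') (x, p)"
      using x' p' Suc.prems(1) assms(2) by (auto simp: Y_def intro!: adjacent_columns)
    then show ?case
      using minimal_le_comparable[OF r(2) Suc.IH[OF p'(2) x'(2)] _ Suc.prems(1)] by blast
  qed
  have "comparable r z" if z: "z \<in> ?X" for z
  proof (cases "z \<in> Y")
    case True
    obtain x p where "z = (x, p)" by fastforce
    moreover have "\<exists>d. x = x0 + d \<or> x0 = x + d" by presburger
    ultimately show ?thesis using below True by (auto simp: comparable_def)
  next
    case False
    then have "comparable z r" using z r(1) by (auto simp: Y_def)
    then show ?thesis by (rule comparable_sym)
  qed
  then show False using r(1) by (auto simp: Y_def)
qed

text \<open>
  The hypothesis says that the interval has at least \<open>2 ^ m - 1\<close> columns. Of \<open>2 ^ Suc m - 1\<close> columns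
  one is removed as universal column, wherever it lies, and one of the sides still has
  \<open>2 ^ m - 1\<close>.
\<close>
lemma ex_chain:
  assumes "2 ^ m \<le> h - l + 1" "h \<le> n"
  shows "\<exists>C \<subseteq> {l..<h} \<times> {..<k}. card C = k * m \<and> (\<forall>x\<in>C. \<forall>y\<in>C. comparable x y)"
  using assms
proof (induction m arbitrary: l h)
  case 0
  then show ?case by (intro exI[of _ "{}"]) auto
next
  case (Suc m)
  have "(1::nat) \<le> 2 ^ m" by simp
  then have "l < h" using Suc.prems(1) unfolding power_Suc by linarith
  then obtain x where x: "x \<in> {l..<h}"
    "\<forall>p<k. \<forall>y\<in>{l..<h} \<times> {..<k}. comparable (x, p) y"
    using ex_universal_column[OF _ Suc.prems(2)] by blast
  have "2 ^ m \<le> x - l + 1 \<or> 2 ^ m \<le> h - Suc x + 1"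
    using Suc.prems(1) x(1) by auto
  then obtain l' h' where lh: "2 ^ m \<le> h' - l' + 1" "h' \<le> n" "{l'..<h'} \<subseteq> {l..<h} - {x}"
  proof
    assume "2 ^ m \<le> x - l + 1"
    moreover have "{l..<x} \<subseteq> {l..<h} - {x}" "x \<le> n" using x(1) Suc.prems(2) by auto
    ultimately show ?thesis using that by blast
  next
    assume "2 ^ m \<le> h - Suc x + 1"
    moreover have "{Suc x..<h} \<subseteq> {l..<h} - {x}" using x(1) by auto
    ultimately show ?thesis using that Suc.prems(2) by blast
  qed
  obtain C where C: "C \<subseteq> {l'..<h'} \<times> {..<k}" "card C = k * m"
    "\<forall>x\<in>C. \<forall>y\<in>C. comparable x y"
    using Suc.IH[OF lh(1,2)] by blast
  have sub: "C \<subseteq> ({l..<h} - {x}) \<times> {..<k}" using C(1) lh(3) by auto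
  have "finite C" using C(1) by (rule finite_subset) simp
  then have "card (C \<union> {x} \<times> {..<k}) = k * Suc m"
    using sub C(2) by (subst card_Un_disjoint) (auto simp: card_cartesian_product)
  moreover have "C \<union> {x} \<times> {..<k} \<subseteq> {l..<h} \<times> {..<k}" using sub x(1) by auto
  moreover have "comparable y z" if "y \<in> C \<union> {x} \<times> {..<k}" "z \<in> C \<union> {x} \<times> {..<k}" for y z
  proof (cases "y \<in> C \<and> z \<in> C")
    case True
    then show ?thesis using C(3) by blast
  next
    case False
    have *: "y \<in> {l..<h} \<times> {..<k}" "z \<in> {l..<h} \<times> {..<k}" using that sub x(1) by auto
    from False that have "y \<in> {x} \<times> {..<k} \<or> z \<in> {x} \<times> {..<k}" by blast
    then show ?thesis
    proof
      assume "y \<in> {x} \<times> {..<k}"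
      then show ?thesis using x(2) *(2) by blast
    next
      assume "z \<in> {x} \<times> {..<k}"
      then have "comparable z y" using x(2) *(1) by blast
      then show ?thesis by (rule comparable_sym)
    qed
  qed
  ultimately show ?case by blast
qed

end


section \<open>Rooted forests\<close>

lemma rooted_forest_parent_unique:
  assumes F: "rooted_forest F" and "(u, w) \<in> parcs F" "(v, w) \<in> parcs F"
  shows "u = v"
proof -
  interpret pair_fin_digraph F using F by (simp add: rooted_forest_def)
  have "in_degree F w \<le> 1" using F assms(2) in_arcsD2 by (auto simp: rooted_forest_def)
  then have "card (in_arcs F w) \<le> Suc 0" by (simp add: in_degree_def)
  moreover have "finite (in_arcs F w)" by (rule finite_in_arcs)
  ultimately have "\<forall>e\<in>in_arcs F w. \<forall>e'\<in>in_arcs F w. e = e'"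
    using card_le_Suc0_iff_eq by blast
  then show ?thesis using assms(2,3) by (auto simp: in_arcs_def)
qed

lemma forest_order_rooted_forest:
  assumes "rooted_forest F"
  shows "forest_order (\<lambda>u v. (u, v) \<in> (parcs F)\<^sup>*)"
proof
  fix x y z
  assume "(x, z) \<in> (parcs F)\<^sup>*" "(y, z) \<in> (parcs F)\<^sup>*"
  moreover have "single_valued ((parcs F)\<inverse>)"
    using rooted_forest_parent_unique[OF assms] by (auto simp: single_valued_def)
  ultimately show "(x, y) \<in> (parcs F)\<^sup>* \<or> (y, x) \<in> (parcs F)\<^sup>*"
    using single_valued_confluent[of "(parcs F)\<inverse>" z x y] by (auto simp: rtrancl_converse)
next
  fix x y
  assume "(x, y) \<in> (parcs F)\<^sup>*" "(y, x) \<in> (parcs F)\<^sup>*"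
  moreover have "acyclic (parcs F)" using assms by (simp add: rooted_forest_def)
  ultimately show "x = y" using acyclic_impl_antisym_rtrancl antisymD by metis
qed auto

lemma vwalk_rtrancl:
  assumes "vwalk p (with_proj F)" "i \<le> j" "j < length p"
  shows "(p ! i, p ! j) \<in> (parcs F)\<^sup>*"
  using assms
proof (induction p arbitrary: i j rule: list.induct)
  case (Cons u p)
  show ?case
  proof (cases "p = []")
    case True
    then show ?thesis using Cons.prems by auto
  next
    case False
    then have p: "vwalk p (with_proj F)" "(u, p ! 0) \<in> parcs F"
      using Cons.prems(1) by (auto elim!: vwalk_consE simp: hd_conv_nth)
    show ?thesis
    proof (cases i)
      case 0
      have "(u, p ! (j - 1)) \<in> (parcs F)\<^sup>*" if "j > 0"
        using Cons.IH[OF p(1), of 0 "j - 1"] p(2) Cons.prems(3) that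
        by (auto intro: converse_rtrancl_into_rtrancl)
      then show ?thesis using 0 by (cases j) auto
    next
      case (Suc i')
      then show ?thesis using Cons.IH[OF p(1), of i' "j - 1"] Cons.prems by (cases j) auto
    qed
  qed
qed auto

lemma ancestor_rtrancl:
  assumes "ancestor F u v"
  shows "(u, v) \<in> (parcs F)\<^sup>*"
proof -
  obtain p where p: "vpath p (with_proj F)" "last p = v" "u \<in> set p"
    using assms by (auto simp: ancestor_def)
  then obtain i where i: "i < length p" "p ! i = u" by (auto simp: in_set_conv_nth)
  moreover have "p ! (length p - 1) = v" using p(2,3) by (cases p rule: rev_cases) auto
  ultimately show ?thesis using vwalk_rtrancl[of p F i "length p - 1"] p(1) by (auto simp: vpath_def)
qed

text \<open>
  Parents are unique, so the parent of a vertex on a path that starts at a root can only be its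
  predecessor on that path.
\<close>
lemma root_path_ancestor_closed:
  assumes F: "rooted_forest F"
    and p: "vwalk p (with_proj F)" "hd p \<in> roots F"
    and "(u, v) \<in> (parcs F)\<^sup>*" "v \<in> set p"
  shows "u \<in> set p"
  using assms(4,5)
proof (induction rule: converse_rtrancl_induct)
  case (step y z)
  interpret pair_fin_digraph F using F by (simp add: rooted_forest_def)
  obtain xs ys where xs: "p = xs @ z # ys" using split_list[of z p] step by blast
  have "xs \<noteq> []"
  proof
    assume "xs = []"
    then have "in_degree F z = 0" using p(2) xs by (simp add: roots_def)
    moreover have "(y, z) \<in> in_arcs F z" using step.hyps(1) by (simp add: in_arcs_def)
    moreover have "finite (in_arcs F z)" by (rule finite_in_arcs)
    ultimately show False by (auto simp: in_degree_def)
  qed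
  then have "(last xs, z) \<in> set (vwalk_arcs p)"
    unfolding xs by (simp add: vwalk_arcs_append)
  then have "(last xs, z) \<in> parcs F" using p(1) by (auto simp: vwalk_def)
  then have "y = last xs" using rooted_forest_parent_unique[OF F] step.hyps(1) by blast
  then show ?case using \<open>xs \<noteq> []\<close> xs by auto
qed

text \<open>
  A longest path through \<open>v\<close> works: in an acyclic graph a further arc into its first or out of its
  last vertex would lead to a new vertex and thus extend the path.
\<close>
lemma ex_root_leaf_path:
  assumes F: "rooted_forest F" and v: "v \<in> pverts F"
  shows "\<exists>p. vpath p (with_proj F) \<and> hd p \<in> roots F \<and> last p \<in> leaves F \<and> v \<in> set p"
proof -
  interpret pair_fin_digraph F using F by (simp add: rooted_forest_def)
  interpret forest_order "\<lambda>u v. (u, v) \<in> (parcs F)\<^sup>*"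
    using F by (rule forest_order_rooted_forest)
  have acyc: "acyclic (parcs F)" using F by (simp add: rooted_forest_def)
  let ?P = "{p. vpath p (with_proj F) \<and> v \<in> set p}"
  have "finite ?P" using vpaths_finite by (rule rev_finite_subset) auto
  moreover have "[v] \<in> ?P" using v by (auto simp: vpath_self)
  ultimately have "finite (length ` ?P)" "Max (length ` ?P) \<in> length ` ?P"
    by (blast intro: Max_in)+
  then obtain p where p: "p \<in> ?P" "\<And>q. q \<in> ?P \<Longrightarrow> length q \<le> length p"
    using Max_ge[of "length ` ?P"] by (metis (no_types, lifting) imageE imageI)
  have walk: "vwalk p (with_proj F)" and dist: "distinct p" and "v \<in> set p"
    using p(1) by (auto simp: vpath_def)
  have "p \<noteq> []" using \<open>v \<in> set p\<close> by auto
  have fromhd: "(hd p, x) \<in> (parcs F)\<^sup>*" if "x \<in> set p" for x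
    using that vwalk_rtrancl[OF walk, of 0] \<open>p \<noteq> []\<close> by (auto simp: in_set_conv_nth hd_conv_nth)
  have tolast: "(x, last p) \<in> (parcs F)\<^sup>*" if "x \<in> set p" for x
    using that vwalk_rtrancl[OF walk, of _ "length p - 1"]
      \<open>p \<noteq> []\<close> by (force simp: in_set_conv_nth last_conv_nth)
  have "hd p \<in> pverts F" "last p \<in> pverts F"
    using walk \<open>p \<noteq> []\<close> by (auto simp: vwalk_def)
  moreover have "in_arcs F (hd p) = {}"
  proof (rule ccontr)
    assume "in_arcs F (hd p) \<noteq> {}"
    then obtain u where u: "(u, hd p) \<in> parcs F" by (auto simp: in_arcs_def)
    then have "u \<notin> set p" using fromhd acyc by (meson acyclic_def rtrancl_into_trancl1)
    moreover have "vwalk (u # p) (with_proj F)" using walk u by (intro vwalk_wf_digraph_consI) auto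
    ultimately have "u # p \<in> ?P" using dist p(1) by auto
    then have "length (u # p) \<le> length p" by (rule p(2))
    then show False by simp
  qed
  moreover have "out_arcs F (last p) = {}"
  proof (rule ccontr)
    assume "out_arcs F (last p) \<noteq> {}"
    then obtain u where u: "(last p, u) \<in> parcs F" by (auto simp: out_arcs_def)
    then have "u \<notin> set p" using tolast acyc by (meson acyclic_def rtrancl_into_trancl2)
    moreover have "vwalk (p @ [u]) (with_proj F)"
      using walk u \<open>p \<noteq> []\<close> in_arcsD2 by (auto simp: vwalk_def set_vwalk_arcs_snoc)
    ultimately have "p @ [u] \<in> ?P" using dist p(1) by auto
    then have "length (p @ [u]) \<le> length p" by (rule p(2))
    then show False by simp
  qed
  ultimately have "hd p \<in> roots F" "last p \<in> leaves F"
    by (auto simp: roots_def leaves_def in_degree_def out_degree_def)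
  then show ?thesis using p(1) by blast
qed

text \<open>
  A root-to-leaf path through the largest element of \<open>C\<close> contains all of its ancestors.
\<close>
lemma card_chain_le_forest_height:
  assumes F: "rooted_forest F" and C: "finite C" "C \<subseteq> pverts F"
    and chain: "\<And>x y. x \<in> C \<Longrightarrow> y \<in> C \<Longrightarrow> (x, y) \<in> (parcs F)\<^sup>* \<or> (y, x) \<in> (parcs F)\<^sup>*"
  shows "card C \<le> forest_height F"
proof (cases "C = {}")
  case False
  interpret pair_fin_digraph F using F by (simp add: rooted_forest_def)
  interpret forest_order "\<lambda>u v. (u, v) \<in> (parcs F)\<^sup>*"
    using F by (rule forest_order_rooted_forest)
  obtain v where v: "v \<in> C" "\<forall>y\<in>C. (v, y) \<in> (parcs F)\<^sup>* \<longrightarrow> y = v"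
    using finite_maximal[OF C(1) False] by blast
  then obtain p where p: "vpath p (with_proj F)" "hd p \<in> roots F" "last p \<in> leaves F" "v \<in> set p"
    using ex_root_leaf_path[OF F] C(2) by blast
  have "C \<subseteq> set p"
  proof
    fix u
    assume "u \<in> C"
    then have "(u, v) \<in> (parcs F)\<^sup>*" using chain v by blast
    then show "u \<in> set p" using root_path_ancestor_closed[OF F _ p(2)] p(1,4) by (auto simp: vpath_def)
  qed
  then have "card C \<le> card (set p)" by (simp add: card_mono)
  also have "\<dots> = length p" using p(1) by (auto simp: vpath_def distinct_card)
  also have "\<dots> \<le> forest_height F"
    unfolding forest_height_def
  proof (rule Max_ge)
    have "finite (length ` {p. vpath p (with_proj F)})" by (intro finite_imageI vpaths_finite)
    then show "finite (insert 0 {length p | p. vpath p (with_proj F) \<and> hd p \<in> roots F \<and> last p \<in> leaves F})"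
      by (intro finite.insertI) (rule rev_finite_subset, auto)
  qed (use p in blast)
  finally show ?thesis .
qed simp

text \<open>
  The treedepth is a least element over the elimination forests, so a lower bound for all of them
  bounds it only if there is one. The directed path along a list of all the vertices serves, as any
  two of its vertices are related.
\<close>
definition list_forest :: "'a list \<Rightarrow> 'a pair_pre_digraph" where
  "list_forest xs = \<lparr> pverts = set xs, parcs = set (vwalk_arcs xs) \<rparr>"

lemma rooted_forest_list_forest:
  assumes "distinct xs"
  shows "rooted_forest (list_forest xs)"
proof -
  let ?F = "list_forest xs"
  have fin: "pair_fin_digraph ?F"
    by unfold_locales (auto simp: list_forest_def dest: arcs_in_vwalk_arcs)
  have index: "\<exists>i. Suc i < length xs \<and> u = xs ! i \<and> v = xs ! Suc i"
    if "(u, v) \<in> set (vwalk_arcs xs)" for u v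
    using that
  proof (induction xs rule: vwalk_arcs.induct)
    case (3 x y xs)
    then consider "u = x" "v = y" | "(u, v) \<in> set (vwalk_arcs (y # xs))" by auto
    then show ?case
    proof cases
      case 1
      then show ?thesis by (intro exI[of _ 0]) simp
    next
      case 2
      then obtain i where "Suc i < length (y # xs)" "u = (y # xs) ! i" "v = (y # xs) ! Suc i"
        using 3 by blast
      then show ?thesis by (intro exI[of _ "Suc i"]) simp
    qed
  qed auto
  have reach: "\<exists>i j. i < j \<and> j < length xs \<and> u = xs ! i \<and> v = xs ! j"
    if "(u, v) \<in> (set (vwalk_arcs xs))\<^sup>+" for u v
    using that
  proof (induction rule: trancl_induct)
    case (base v)
    then show ?case using index by blast
  next
    case (step v w)
    then obtain i j l where ij: "i < j" "j < length xs" "u = xs ! i" "v = xs ! j"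
      "Suc l < length xs" "v = xs ! l" "w = xs ! Suc l"
      using index by blast
    then have "l = j" using assms by (simp add: nth_eq_iff_index_eq)
    then show ?case using ij by (intro exI[of _ i] exI[of _ "Suc l"]) auto
  qed
  have "acyclic (parcs ?F)"
    unfolding acyclic_def list_forest_def using reach assms
    by (fastforce simp: nth_eq_iff_index_eq)
  moreover have "in_degree ?F v \<le> 1" for v
  proof -
    have "card (in_arcs ?F v) \<le> Suc 0"
    proof (subst card_le_Suc0_iff_eq)
      show "\<forall>e\<in>in_arcs ?F v. \<forall>e'\<in>in_arcs ?F v. e = e'"
      proof (intro ballI)
        fix e e'
        assume "e \<in> in_arcs ?F v" "e' \<in> in_arcs ?F v"
        then obtain u u' where u: "e = (u, v)" "e' = (u', v)"
          "(u, v) \<in> set (vwalk_arcs xs)" "(u', v) \<in> set (vwalk_arcs xs)"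
          by (cases e; cases e') (auto simp: in_arcs_def list_forest_def)
        obtain i j where "Suc i < length xs" "u = xs ! i" "v = xs ! Suc i"
          "Suc j < length xs" "u' = xs ! j" "v = xs ! Suc j"
          using index[OF u(3)] index[OF u(4)] by blast
        moreover from this have "i = j" using assms by (metis nth_eq_iff_index_eq nat.inject)
        ultimately show "e = e'" using u by simp
      qed
    qed (simp add: in_arcs_def list_forest_def)
    then show ?thesis by (simp add: in_degree_def)
  qed
  ultimately show ?thesis using fin by (simp add: rooted_forest_def)
qed

lemma ancestor_list_forest:
  assumes "distinct xs" "i \<le> j" "j < length xs"
  shows "ancestor (list_forest xs) (xs ! i) (xs ! j)"
proof -
  let ?F = "list_forest xs" and ?p = "take (Suc j) xs"
  have "vwalk xs ?F" using assms(3) by (auto simp: list_forest_def vwalk_def)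
  then have "vwalk ?p ?F"
    using vwalkI_append_l[of ?p "drop (Suc j) xs"] assms(3) by auto
  then have "vpath ?p ?F" using assms(1) by (simp add: vpath_def)
  moreover have "hd ?p \<in> roots ?F"
  proof -
    have "(u, hd xs) \<notin> set (vwalk_arcs xs)" for u
    proof
      assume "(u, hd xs) \<in> set (vwalk_arcs xs)"
      moreover have "snd e \<in> set (tl xs)" if "e \<in> set (vwalk_arcs xs)" for e
        using that by (induction xs rule: vwalk_arcs.induct) (auto simp: arcs_in_vwalk_arcs)
      ultimately show False using assms(1) by (cases xs) force+
    qed
    then have "in_arcs ?F (hd xs) = {}" by (auto simp: in_arcs_def list_forest_def)
    moreover have "hd xs \<in> set xs" using assms(3) by (intro hd_in_set) auto
    ultimately show ?thesis using assms(3)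
      by (auto simp: roots_def in_degree_def list_forest_def hd_take)
  qed
  moreover have "last ?p = xs ! j" using assms(3) by (simp add: take_Suc_conv_app_nth)
  moreover have "xs ! i \<in> set ?p"
    using assms(2,3) by (auto simp: in_set_conv_nth intro!: exI[of _ i])
  ultimately show ?thesis by (auto simp: ancestor_def)
qed

lemma ex_elimination_forest:
  assumes "pair_graph G"
  shows "\<exists>F. elimination_forest G F"
proof -
  interpret pair_graph G by fact
  obtain xs where xs: "set xs = pverts G" "distinct xs"
    using finite_distinct_list[OF pair_finite_verts] by blast
  have "ancestor (list_forest xs) u v \<or> ancestor (list_forest xs) v u"
    if "(u, v) \<in> parcs G" for u v
  proof -
    have "u \<in> set xs" "v \<in> set xs" using that xs(1) in_arcsD1 in_arcsD2 by auto
    then obtain i j where "i < length xs" "u = xs ! i" "j < length xs" "v = xs ! j"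
      by (metis in_set_conv_nth)
    then show ?thesis using ancestor_list_forest[OF xs(2)] nat_le_linear[of i j] by blast
  qed
  moreover have "pverts (list_forest xs) = pverts G" by (simp add: list_forest_def xs)
  ultimately show ?thesis
    using rooted_forest_list_forest[OF xs(2)] by (auto simp: elimination_forest_def)
qed


section \<open>Treedepth of blow-ups of paths\<close>

lemma treedepth_blowup_path:
  assumes "2 ^ m \<le> n + 1"
  shows "k * m \<le> treedepth (clique_blowup (path_graph n) k)" (is "_ \<le> treedepth ?G")
proof -
  have "\<exists>F. elimination_forest ?G F"
    by (intro ex_elimination_forest pair_graph_clique_blowup pair_graph_path_graph)
  then have "\<exists>h F. elimination_forest ?G F \<and> forest_height F = h" by blast
  then have "\<exists>F. elimination_forest ?G F \<and> forest_height F = treedepth ?G"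
    unfolding treedepth_def by (rule LeastI_ex)
  then obtain F where F: "elimination_forest ?G F" "forest_height F = treedepth ?G" by blast
  have rooted: "rooted_forest F" using F(1) by (simp add: elimination_forest_def)
  interpret forest_order "\<lambda>u v. (u, v) \<in> (parcs F)\<^sup>*"
    using rooted by (rule forest_order_rooted_forest)
  interpret forest_order_blowup "\<lambda>u v. (u, v) \<in> (parcs F)\<^sup>*" n k
  proof
    fix i j p q
    assume *: "i < n" "j < n" "p < k" "q < k" "i = j \<or> j = Suc i \<or> i = Suc j"
    show "comparable (i, p) (j, q)"
    proof (cases "(i, p) = (j, q)")
      case True
      then show ?thesis by (simp add: comparable_def)
    next
      case False
      then have "((i, p), (j, q)) \<in> parcs ?G"
        using * by (auto simp: clique_blowup_def path_graph_def)
      then have "ancestor F (i, p) (j, q) \<or> ancestor F (j, q) (i, p)"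
        using F(1) by (auto simp: elimination_forest_def)
      then show ?thesis by (auto simp: comparable_def dest: ancestor_rtrancl)
    qed
  qed
  obtain C where C: "C \<subseteq> {0..<n} \<times> {..<k}" "card C = k * m" "\<forall>x\<in>C. \<forall>y\<in>C. comparable x y"
    using ex_chain[of m n 0] assms by auto
  have "C \<subseteq> pverts F"
    using C(1) F(1) by (auto simp: elimination_forest_def clique_blowup_def path_graph_def)
  moreover have "finite C" using C(1) by (rule finite_subset) simp
  ultimately have "card C \<le> forest_height F"
    using C(3) by (intro card_chain_le_forest_height[OF rooted]) (auto simp: comparable_def)
  then show ?thesis using C(2) F(2) by simp
qed


section \<open>Pathwidth, longest paths and treedepth of the example\<close>

lemma vpath_length_le:
  assumes "pair_graph G" "vpath p (with_proj G)"
  shows "length p \<le> card (pverts G)"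
proof -
  interpret pair_graph G by fact
  have "length p = card (set p)" using assms(2) by (auto simp: vpath_def distinct_card)
  also have "\<dots> \<le> card (pverts G)"
    using assms(2) pair_finite_verts by (intro card_mono) (auto simp: vpath_def vwalk_def)
  finally show ?thesis .
qed

theorem mainTheorem2:
  fixes a b c :: nat and G :: "(nat \<times> nat) pair_pre_digraph"
  assumes "c < b" and "1 \<le> c" and "a = 2 ^ c"
    and "G = clique_blowup (path_graph (2 ^ (b - c))) (a div 2)"
  shows "pathwidth G = int a - 1 \<and>
    \<not> (\<exists>p. vpath p G \<and> length p = 2 ^ b) \<and>
    real (treedepth G) \<ge> real a / 2 * (real b - real c)"
proof (intro conjI notI)
  define k where "k = a div 2"
  define m where "m = b - c"
  have G: "G = clique_blowup (path_graph (2 ^ m)) k" using assms(4) by (simp add: k_def m_def)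
  have a: "a = 2 * k" using assms(2,3) by (cases c) (auto simp: k_def)
  have "1 \<le> k" using a assms(3) by (cases k) auto
  have "2 ^ 1 \<le> (2::nat) ^ m" using assms(1) by (intro power_increasing) (auto simp: m_def)
  then show "pathwidth G = int a - 1"
    using pathwidth_blowup_path[of "2 ^ m" k] \<open>1 \<le> k\<close> by (simp add: G a)
  have "k * m \<le> treedepth G" unfolding G by (rule treedepth_blowup_path) simp
  then have "real (k * m) \<le> real (treedepth G)" by (rule of_nat_mono)
  then show "real a / 2 * (real b - real c) \<le> real (treedepth G)"
    using assms(1) by (simp add: a m_def of_nat_diff)
  assume "\<exists>p. vpath p G \<and> length p = 2 ^ b"
  then obtain p where "vpath p G" "length p = 2 ^ b" by blast
  then have "2 ^ b \<le> card (pverts G)"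
    using vpath_length_le[of G p] pair_graph_clique_blowup[OF pair_graph_path_graph] G by metis
  also have "\<dots> = 2 ^ m * k" by (simp add: G clique_blowup_def path_graph_def card_cartesian_product)
  also have "\<dots> < 2 ^ m * a" using \<open>1 \<le> k\<close> a by simp
  also have "\<dots> = 2 ^ b" using assms(1) by (simp add: assms(3) m_def flip: power_add)
  finally show False by simp
qed

end
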